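(* Let $L\subset\mathbb{C}_\infty$ be a finite extension of $K$, let $E=(\mathbb{G}_a^d,\phi)$ be a $d$-dimensional $t$-module defined over $L$, and let $P_1,\dots,P_\ell\in E(L)=\mathrm{Mat}_{d\times 1}(L)$. Assume that $P_1,\dots,P_\ell$ are linearly independent over $\mathbb{F}_q$. Then the following assertions hold. 1. The map $\rho_1:\mathrm{Sol}_\phi(P_1,\dots,P_\ell)\to\mathcal{R}$, $(\bm{x},a_1,\dots,a_\ell)\mapsto(a_1,\dots,a_\ell)$, is an $\mathbb{F}_q[t]$-module isomorphism. 2. The map $\rho_2:\mathrm{Sol}_\phi(P_1,\dots,P_\ell)\to\mathfrak{sp}_\phi(P_1,\dots,P_\ell)$, $(\bm{x},a_1,\dots,a_\ell)\mapsto(\phi_t-t)\bm{x}$, is an $\mathbb{F}_q[t]$-module isomorphism. 3. The map $\rho_3:=\rho_2\circ\rho_1^{-1}:\mathcal{R}\to\mathfrak{sp}_\phi(P_1,\dots,P_\ell)$, $(a_1,\dots,a_\ell)\mapsto a_1P_1+\cdots+a_\ell P_\ell$, is an $\mathbb{F}_q[t]$-module isomorphism.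
   Context: $\mathbb{F}_q$ is a finite field with $q$ elements, $K=\mathbb{F}_q(\theta)$, and $\mathbb{C}_\infty$ is the completion of an algebraic closure of $\mathbb{F}_q(\!(1/\theta)\!)$. $L[t,\tau]$ is the twisted polynomial ring in two variables with $\alpha t=t\alpha$, $t\tau=\tau t$, $\tau\alpha=\alpha^q\tau$ for $\alpha\in L$; $L[\tau]\subset L[t,\tau]$ is the subring of elements not involving $t$. For $f=\sum_i c_it^i\in L[t]$ put $f^{(n)}=\sum_i c_i^{q^n}t^i$, extended entrywise to matrices. A matrix $A=\sum_iA_i\tau^i\in\mathrm{Mat}_{d\times d}(L[t,\tau])$ with $A_i\in\mathrm{Mat}_{d\times d}(L[t])$ acts on $\mathrm{Mat}_{d\times 1}(L[t])$ by $A\bm{v}=\sum_iA_i\bm{v}^{(i)}$. A $d$-dimensional $t$-module defined over $L$ ($d>0$) is a pair $E=(\mathbb{G}_a^d,\phi)$, where $\phi:\mathbb{F}_q[t]\to\mathrm{Mat}_{d\times d}(L[\tau])$, $a\mapsto\phi_a$, is an $\mathbb{F}_q$-algebra homomorphism such that $\partial\phi_t-\theta\,\mathrm{Id}_d$ is nilpotent; here $\partial\phi_t$ is the $\tau^0$-coefficient of $\phi_t$. Set $E[t]:=E(L)\otimes_{\mathbb{F}_q}\mathbb{F}_q[t]=\mathrm{Mat}_{d\times 1}(L[t])$, and regard $E(L)\subset E[t]$ as the constants in $t$. Define - $\mathcal{R}=\{(a_1,\dots,a_\ell)\in\mathbb{F}_q[t]^{\oplus\ell}\mid\phi_{a_1}(P_1)+\cdots+\phi_{a_\ell}(P_\ell)=0\}$;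 - $\mathrm{Sol}_\phi(P_1,\dots,P_\ell)=\{(\bm{x},a_1,\dots,a_\ell)\in E[t]\times\mathbb{F}_q[t]^{\oplus\ell}\mid(\phi_t-t)\bm{x}=a_1P_1+\cdots+a_\ell P_\ell\}$; - $\mathscr{M}_2=\{a_1P_1+\cdots+a_\ell P_\ell\mid a_i\in\mathbb{F}_q[t]\}\subset E[t]$ (ordinary multiplication of the vector $P_i$ by the polynomial $a_i$); - $\mathfrak{sp}_\phi(P_1,\dots,P_\ell)=\mathscr{M}_2\cap(\phi_t-t)E[t]$ (the special polynomials). The $\mathbb{F}_q[t]$-module structures on these sets are all given by ordinary multiplication by polynomials in $t$ (in $\mathbb{F}_q[t]^{\oplus\ell}$ and in $\mathrm{Mat}_{d\times 1}(L[t])$). *)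

theory Defs
  imports
    "HOL-Analysis.Analysis"
    "HOL-Computational_Algebra.Computational_Algebra"
begin

section \<open>The field \<open>C\<^sub>\<infinity>\<close>\<close>

text \<open>
  The finite field with \<open>q\<close> elements is a type \<open>'k\<close>, so \<open>q = CARD('k)\<close>. The formal variable of
  \<open>'k fls\<close> stands for \<open>1/\<theta>\<close>; hence \<open>\<theta>\<close> is \<open>fls_X_inv\<close>. The absolute value of \<open>x\<close> is \<open>dist x 0\<close>.
\<close>

definition algebraic_elements :: "('k::field fls \<Rightarrow> 'c::field) \<Rightarrow> 'c set" where
  "algebraic_elements emb = {x. \<exists>p :: 'k fls poly. p \<noteq> 0 \<and> poly (map_poly emb p) x = 0}"

text \<open>
  \<open>'c\<close> is complete, carries an absolute value extending the one of \<open>F\<^sub>q((1/\<theta>))\<close>, and the elements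
  algebraic over \<open>F\<^sub>q((1/\<theta>))\<close> form an algebraic closure of it which is dense in \<open>'c\<close>. This
  determines \<open>'c\<close> as the completion of an algebraic closure of \<open>F\<^sub>q((1/\<theta>))\<close> up to isometric
  isomorphism.
\<close>

locale C_infinity =
  fixes emb :: "'k::{field,finite} fls \<Rightarrow> 'c::{field,complete_space}"
  assumes emb_one: "emb 1 = 1"
    and emb_add: "emb (f + g) = emb f + emb g"
    and emb_mult: "emb (f * g) = emb f * emb g"
    and dist_translate: "dist (x + z) (y + z) = dist x (y :: 'c)"
    and abs_mult: "dist (x * y) (0 :: 'c) = dist x 0 * dist y 0"
    and abs_ultrametric: "dist (x + y) (0 :: 'c) \<le> max (dist x 0) (dist y 0)"
    and abs_emb: "f \<noteq> 0 \<Longrightarrow> dist (emb f) 0 = real CARD('k) powi (- fls_subdegree f)"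
    and algebraic_elements_closed:
      "(\<forall>i. coeff p i \<in> algebraic_elements emb) \<Longrightarrow> degree p > 0 \<Longrightarrow>
         \<exists>x\<in>algebraic_elements emb. poly p x = 0"
    and algebraic_elements_dense: "closure (algebraic_elements emb) = UNIV"

definition theta :: "('k::field fls \<Rightarrow> 'c) \<Rightarrow> 'c" where
  "theta emb = emb fls_X_inv"

definition emb_Fq :: "('k::field fls \<Rightarrow> 'c) \<Rightarrow> 'k \<Rightarrow> 'c" where
  "emb_Fq emb c = emb (fls_const c)"

definition emb_Fqt :: "('k::field fls \<Rightarrow> 'c::field) \<Rightarrow> 'k poly \<Rightarrow> 'c poly" where
  "emb_Fqt emb a = map_poly (emb_Fq emb) a"

definition field_K :: "('k::field fls \<Rightarrow> 'c::field) \<Rightarrow> 'c set" where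
  "field_K emb = {poly (emb_Fqt emb a) (theta emb) / poly (emb_Fqt emb b) (theta emb) | a b. b \<noteq> 0}"

definition is_subfield :: "'c::field set \<Rightarrow> bool" where
  "is_subfield L \<longleftrightarrow> 0 \<in> L \<and> 1 \<in> L \<and>
     (\<forall>x\<in>L. \<forall>y\<in>L. x + y \<in> L \<and> x * y \<in> L) \<and> (\<forall>x\<in>L. - x \<in> L \<and> inverse x \<in> L)"

definition finite_extension_of_K :: "('k::field fls \<Rightarrow> 'c::field) \<Rightarrow> 'c set \<Rightarrow> bool" where
  "finite_extension_of_K emb L \<longleftrightarrow> is_subfield L \<and> field_K emb \<subseteq> L \<and>
     (\<exists>B. finite B \<and> L = {\<Sum>b\<in>B. c b * b | c. \<forall>b\<in>B. c b \<in> field_K emb})"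


section \<open>Twisted polynomials and \<open>t\<close>-modules\<close>

text \<open>
  An element of \<open>L[t,\<tau>]\<close> is a \<open>'c poly poly\<close>: the outer variable is \<open>\<tau>\<close>, the inner one is \<open>t\<close>, and
  coefficients are written to the left of the powers of \<open>\<tau>\<close>. Only its additive structure agrees with
  the one of \<open>L[t,\<tau>]\<close>; the product of \<open>L[t,\<tau>]\<close> is \<open>tau_mult\<close>, not \<open>*\<close>.
\<close>

definition twist :: "nat \<Rightarrow> nat \<Rightarrow> 'c::field poly \<Rightarrow> 'c poly" where
  "twist q n f = map_poly (\<lambda>c. c ^ (q ^ n)) f"

definition tau_mult :: "nat \<Rightarrow> 'c::field poly poly \<Rightarrow> 'c poly poly \<Rightarrow> 'c poly poly" where
  "tau_mult q A B =
     (\<Sum>i\<le>degree A. \<Sum>j\<le>degree B. monom (coeff A i * twist q i (coeff B j)) (i + j))"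

lemma tau_mult_commutation:
  assumes "q > 0"
  shows "tau_mult q (monom 1 1) [:[:\<alpha>:]:] = tau_mult q [:[:\<alpha> ^ q:]:] (monom 1 1)"
    and "tau_mult q (monom 1 1) [:[:0, 1:]:] = tau_mult q [:[:0, 1:]:] (monom 1 1)"
  using assms by (simp_all add: tau_mult_def twist_def degree_monom_eq map_poly_pCons)

definition tau_act :: "nat \<Rightarrow> 'c::field poly poly \<Rightarrow> 'c poly \<Rightarrow> 'c poly" where
  "tau_act q A f = (\<Sum>i\<le>degree A. coeff A i * twist q i f)"

definition mat_tau_mult ::
  "nat \<Rightarrow> 'c::field poly poly^'d^'d \<Rightarrow> 'c poly poly^'d^'d \<Rightarrow> 'c poly poly^'d^'d" where
  "mat_tau_mult q A B = (\<chi> i j. \<Sum>k\<in>UNIV. tau_mult q (A $ i $ k) (B $ k $ j))"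

definition mat_act :: "nat \<Rightarrow> 'c::field poly poly^'d^'d \<Rightarrow> 'c poly^'d \<Rightarrow> 'c poly^'d" where
  "mat_act q A v = (\<chi> i. \<Sum>j\<in>UNIV. tau_act q (A $ i $ j) (v $ j))"

definition L_tau :: "'c::field set \<Rightarrow> 'c poly poly set" where
  "L_tau L = {A. \<forall>i. \<exists>c\<in>L. coeff A i = [:c:]}"

definition nilpotent_matrix :: "'c::field^'d^'d \<Rightarrow> bool" where
  "nilpotent_matrix N \<longleftrightarrow> (\<exists>n. (((**) N) ^^ n) (mat 1) = 0)"

text \<open>The \<open>\<tau>\<^sup>0\<close>-coefficient of a matrix over \<open>L[\<tau>]\<close>, whose \<open>\<tau>\<close>-coefficients are constant in \<open>t\<close>.\<close>

definition tau0_coeff :: "'c::field poly poly^'d^'d \<Rightarrow> 'c^'d^'d" where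
  "tau0_coeff A = map_matrix (\<lambda>f. coeff (coeff f 0) 0) A"

definition t_module ::
  "('k::{field,finite} fls \<Rightarrow> 'c::field) \<Rightarrow> 'c set \<Rightarrow> ('k poly \<Rightarrow> 'c poly poly^'d^'d) \<Rightarrow> bool" where
  "t_module emb L \<phi> \<longleftrightarrow>
     (\<forall>a i j. \<phi> a $ i $ j \<in> L_tau L) \<and>
     \<phi> 1 = mat 1 \<and>
     (\<forall>a b. \<phi> (a + b) = \<phi> a + \<phi> b) \<and>
     (\<forall>a b. \<phi> (a * b) = mat_tau_mult CARD('k) (\<phi> a) (\<phi> b)) \<and>
     (\<forall>c a. \<phi> (smult c a) = map_matrix (smult [:emb_Fq emb c:]) (\<phi> a)) \<and>
     nilpotent_matrix (tau0_coeff (\<phi> [:0, 1:]) - mat (theta emb))"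

definition E_L :: "'c::field set \<Rightarrow> ('c^'d) set" where
  "E_L L = {v. \<forall>i. v $ i \<in> L}"

definition E_t :: "'c::field set \<Rightarrow> ('c poly^'d) set" where
  "E_t L = {x. \<forall>i n. coeff (x $ i) n \<in> L}"

definition const_vec :: "'c::field^'d \<Rightarrow> 'c poly^'d" where
  "const_vec v = (\<chi> i. [:v $ i:])"

definition phi_t_minus_t ::
  "('k::{field,finite} poly \<Rightarrow> 'c::field poly poly^'d^'d) \<Rightarrow> 'c poly^'d \<Rightarrow> 'c poly^'d" where
  "phi_t_minus_t \<phi> x = mat_act CARD('k) (\<phi> [:0, 1:] - mat [:[:0, 1:]:]) x"


section \<open>Relations, solutions and special polynomials\<close>

definition linearly_independent_Fq ::
  "('k::field fls \<Rightarrow> 'c::field) \<Rightarrow> ('l::finite \<Rightarrow> 'c^'d) \<Rightarrow> bool" where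
  "linearly_independent_Fq emb P \<longleftrightarrow>
     (\<forall>c. (\<Sum>i\<in>UNIV. emb_Fq emb (c i) *s P i) = 0 \<longrightarrow> (\<forall>i. c i = 0))"

definition relations ::
  "('k::{field,finite} poly \<Rightarrow> 'c::field poly poly^'d^'d) \<Rightarrow> ('l::finite \<Rightarrow> 'c^'d) \<Rightarrow>
   ('k poly^'l) set" where
  "relations \<phi> P = {a. (\<Sum>i\<in>UNIV. mat_act CARD('k) (\<phi> (a $ i)) (const_vec (P i))) = 0}"

definition combination ::
  "('k::field fls \<Rightarrow> 'c::field) \<Rightarrow> ('l::finite \<Rightarrow> 'c^'d) \<Rightarrow> 'k poly^'l \<Rightarrow> 'c poly^'d" where
  "combination emb P a = (\<Sum>i\<in>UNIV. emb_Fqt emb (a $ i) *s const_vec (P i))"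

definition Sol ::
  "('k::{field,finite} fls \<Rightarrow> 'c::field) \<Rightarrow> 'c set \<Rightarrow> ('k poly \<Rightarrow> 'c poly poly^'d^'d) \<Rightarrow>
   ('l::finite \<Rightarrow> 'c^'d) \<Rightarrow> (('c poly^'d) \<times> ('k poly^'l)) set" where
  "Sol emb L \<phi> P = {(x, a). x \<in> E_t L \<and> phi_t_minus_t \<phi> x = combination emb P a}"

definition module_M2 ::
  "('k::field fls \<Rightarrow> 'c::field) \<Rightarrow> ('l::finite \<Rightarrow> 'c^'d) \<Rightarrow> ('c poly^'d) set" where
  "module_M2 emb P = {combination emb P a | a. True}"

definition special_polynomials ::
  "('k::{field,finite} fls \<Rightarrow> 'c::field) \<Rightarrow> 'c set \<Rightarrow> ('k poly \<Rightarrow> 'c poly poly^'d^'d) \<Rightarrow>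
   ('l::finite \<Rightarrow> 'c^'d) \<Rightarrow> ('c poly^'d) set" where
  "special_polynomials emb L \<phi> P = module_M2 emb P \<inter> phi_t_minus_t \<phi> ` E_t L"

definition rho1 :: "('c::field poly^'d) \<times> ('k::field poly^'l) \<Rightarrow> 'k poly^'l" where
  "rho1 = (\<lambda>(x, a). a)"

definition rho2 ::
  "('k::{field,finite} poly \<Rightarrow> 'c::field poly poly^'d^'d) \<Rightarrow> ('c poly^'d) \<times> ('k poly^'l) \<Rightarrow> 'c poly^'d"
  where "rho2 \<phi> = (\<lambda>(x, a). phi_t_minus_t \<phi> x)"

text \<open>The three \<open>F\<^sub>q[t]\<close>-scalar multiplications; on tuples of polynomials it is \<open>*s\<close>.\<close>

definition scale_Et :: "('k::field fls \<Rightarrow> 'c::field) \<Rightarrow> 'k poly \<Rightarrow> 'c poly^'d \<Rightarrow> 'c poly^'d" where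
  "scale_Et emb a x = emb_Fqt emb a *s x"

definition scale_Sol :: "('k::field fls \<Rightarrow> 'c::field) \<Rightarrow> 'k poly \<Rightarrow>
    ('c poly^'d) \<times> ('k poly^'l) \<Rightarrow> ('c poly^'d) \<times> ('k poly^'l)" where
  "scale_Sol emb a = (\<lambda>(x, b). (scale_Et emb a x, a *s b))"

definition submodule_iso ::
  "('r::comm_ring_1 \<Rightarrow> 'u::ab_group_add \<Rightarrow> 'u) \<Rightarrow> 'u set \<Rightarrow>
   ('r \<Rightarrow> 'v::ab_group_add \<Rightarrow> 'v) \<Rightarrow> 'v set \<Rightarrow> ('u \<Rightarrow> 'v) \<Rightarrow> bool" where
  "submodule_iso s1 S s2 T f \<longleftrightarrow>
     module s1 \<and> module.subspace s1 S \<and> module s2 \<and> module.subspace s2 T \<and>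
     (\<forall>x\<in>S. \<forall>y\<in>S. f (x + y) = f x + f y) \<and> (\<forall>r. \<forall>x\<in>S. f (s1 r x) = s2 r (f x)) \<and>
     bij_betw f S T"

end

theory Submission
  imports Defs
begin

text \<open>
  Everything rests on two properties of \<open>\<phi>\<^sub>t\<close> acting on \<open>E[t]\<close>.

  Since the \<open>\<tau>\<close>-coefficients of \<open>\<phi>\<^sub>t\<close> are constant in \<open>t\<close>, this action never raises the degree in \<open>t\<close>,
  whereas multiplication by \<open>t\<close> raises it by one. Hence \<open>(\<phi>\<^sub>t - t) x\<close> has degree one more than \<open>x\<close>, and
  it can be constant in \<open>t\<close> only if \<open>x = 0\<close> (\<open>eq_0_if_phi_t_minus_t_const\<close>). In particular
  \<open>\<phi>\<^sub>t - t\<close> is injective, so a solution \<open>(x, a)\<close> is determined by \<open>a\<close>: this makes \<open>\<rho>\<^sub>1\<close> injective.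
  It also makes \<open>\<rho>\<^sub>2\<close> injective, because linear independence of the \<open>P\<^sub>i\<close> over \<open>F\<^sub>q\<close> allows one to
  recover \<open>a\<close> from \<open>\<Sum> a\<^sub>i P\<^sub>i\<close>.

  Modulo the image of \<open>\<phi>\<^sub>t - t\<close>, multiplication by \<open>t\<close> agrees with \<open>\<phi>\<^sub>t\<close>, hence multiplication
  by \<open>a \<in> F\<^sub>q[t]\<close> agrees with \<open>\<phi>\<^sub>a\<close> (\<open>scale_minus_phi_in_image\<close>). So \<open>\<Sum> a\<^sub>i P\<^sub>i\<close> is congruent to the
  vector \<open>\<Sum> \<phi>\<^bsub>a\<^sub>i\<^esub>(P\<^sub>i)\<close>, which is constant in \<open>t\<close> and therefore lies in the image only if it
  vanishes. Thus \<open>a\<close> is a relation exactly if \<open>\<Sum> a\<^sub>i P\<^sub>i\<close> lies in \<open>(\<phi>\<^sub>t - t) E[t]\<close>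
  (\<open>relation_iff_combination_in_image\<close>), so the image of \<open>\<rho>\<^sub>1\<close> is \<open>R\<close>; \<open>\<rho>\<^sub>2\<close> is surjective by
  the definition of special polynomials.

  All maps are linear over \<open>F\<^sub>q[t]\<close> because \<open>c \<mapsto> c\<^sup>q\<close> is additive on \<open>C\<^sub>\<infinity>\<close> and fixes \<open>F\<^sub>q\<close>.
\<close>

section \<open>Isomorphisms between submodules\<close>

lemma submodule_iso_if_inj_on:
  assumes "module_hom s1 s2 f" "module.subspace s1 S" "inj_on f S" "f ` S = T"
  shows "submodule_iso s1 S s2 T f"
proof -
  interpret module_hom s1 s2 f by fact
  have "m2.subspace T" using subspace_image[OF assms(2)] assms(4) by simp
  then show ?thesis
    unfolding submodule_iso_def bij_betw_def
    using assms m1.module_axioms m2.module_axioms by (auto simp: add scale)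
qed

lemma submodule_iso_inv_into:
  assumes "submodule_iso s1 S s2 T f"
  shows "submodule_iso s2 T s1 S (inv_into S f)"
proof -
  interpret m1: module s1 using assms by (simp add: submodule_iso_def)
  have S: "m1.subspace S" and bij: "bij_betw f S T"
    and add: "\<And>x y. x \<in> S \<Longrightarrow> y \<in> S \<Longrightarrow> f (x + y) = f x + f y"
    and scale: "\<And>r x. x \<in> S \<Longrightarrow> f (s1 r x) = s2 r (f x)"
    using assms by (auto simp: submodule_iso_def)
  have inj: "inj_on f S" and T: "T = f ` S" using bij by (auto simp: bij_betw_def)
  have "inv_into S f (f x + f y) = x + y" if "x \<in> S" "y \<in> S" for x y
    using that inv_into_f_f[OF inj m1.subspace_add[OF S that]] by (simp add: add)
  moreover have "inv_into S f (s2 r (f x)) = s1 r x" if "x \<in> S" for r x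
    using that inv_into_f_f[OF inj m1.subspace_scale[OF S that]] by (simp add: scale)
  ultimately show ?thesis
    using assms bij_betw_inv_into[OF bij]
    by (auto simp: submodule_iso_def T inv_into_f_f[OF inj])
qed

lemma submodule_iso_comp:
  assumes "submodule_iso s1 S s2 T f" "submodule_iso s2 T s3 U g"
  shows "submodule_iso s1 S s3 U (g \<circ> f)"
proof -
  have "f x \<in> T" if "x \<in> S" for x
    using assms(1) that by (auto simp: submodule_iso_def dest: bij_betwE)
  then show ?thesis
    using assms by (auto simp: submodule_iso_def intro: bij_betw_trans)
qed

section \<open>The Frobenius endomorphism\<close>

lemma finite_field_power_card:
  fixes x :: "'k :: {field,finite}"
  shows "x ^ CARD('k) = x"
proof (cases "x = 0")
  case False
  \<comment> \<open>Multiplication by \<open>x\<close> permutes the nonzero elements.\<close>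
  have "x * (\<Prod>y\<in>UNIV-{0}. x * y) = x * x ^ (CARD('k) - 1) * \<Prod>(UNIV-{0})"
    by (simp add: prod.distrib mult_ac)
  also have "x * x ^ (CARD('k) - 1) = x ^ CARD('k)"
    by (simp flip: power_Suc)
  also have "(\<Prod>y\<in>UNIV-{0}. x * y) = (\<Prod>y\<in>UNIV-{0}. y)"
    by (rule prod.reindex_bij_witness[of _ "\<lambda>y. y / x" "\<lambda>y. x * y"]) (use False in auto)
  finally show ?thesis
    by simp
qed simp

text \<open>
  The polynomials \<open>(X + 1)\<^sup>q\<close> and \<open>X\<^sup>q + 1\<close> are monic of degree \<open>q\<close> and take the same value
  \<open>x + 1\<close> at each of the \<open>q\<close> elements \<open>x\<close> of the field, so they are equal.
\<close>
lemma finite_field_binomial_eq_0: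
  assumes "0 < i" "i < CARD('k)"
  shows "of_nat (CARD('k) choose i) = (0 :: 'k :: {field,finite})"
proof -
  let ?q = "CARD('k)"
  have "[:1, 1:] ^ ?q = monom (1::'k) ?q + 1"
  proof (rule poly_eqI_degree_lead_coeff[where n = ?q and A = UNIV])
    show "coeff ([:1, 1:] ^ ?q) ?q = coeff (monom (1::'k) ?q + 1) ?q"
      by (simp add: coeff_linear_power)
    show "degree ([:1, 1 :: 'k:] ^ ?q) \<le> ?q"
      by (simp add: degree_power_eq)
    show "degree (monom (1::'k) ?q + 1) \<le> ?q"
      by (intro degree_add_le) (simp_all add: degree_monom_le)
    show "poly ([:1, 1:] ^ ?q) z = poly (monom 1 ?q + 1) z" for z :: 'k
      by (simp add: poly_monom finite_field_power_card)
  qed simp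
  then have "coeff ([:1, 1:] ^ ?q) i = coeff (monom (1::'k) ?q + 1) i" by simp
  then show ?thesis
    using assms by (simp add: coeff_linear_poly_power)
qed

context C_infinity
begin

lemma emb_Fq_add: "emb_Fq emb (x + y) = emb_Fq emb x + emb_Fq emb y"
  by (simp add: emb_Fq_def emb_add flip: fls_plus_const)

lemma emb_Fq_mult: "emb_Fq emb (x * y) = emb_Fq emb x * emb_Fq emb y"
  by (simp add: emb_Fq_def flip: emb_mult)

lemma emb_Fq_1 [simp]: "emb_Fq emb 1 = 1"
  by (simp add: emb_Fq_def emb_one)

lemma emb_Fq_0 [simp]: "emb_Fq emb 0 = 0"
  using emb_Fq_add[of 0 0] by (metis add_0 add_cancel_right_right)

lemma emb_Fq_sum: "emb_Fq emb (sum f A) = (\<Sum>x\<in>A. emb_Fq emb (f x))"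
  by (induction A rule: infinite_finite_induct) (simp_all add: emb_Fq_add)

lemma emb_Fq_power: "emb_Fq emb (x ^ n) = emb_Fq emb x ^ n"
  by (induction n) (simp_all add: emb_Fq_mult)

lemma emb_Fq_of_nat: "emb_Fq emb (of_nat n) = of_nat n"
  by (induction n) (simp_all add: emb_Fq_add)

lemma frobenius_add: "(x + y) ^ CARD('k) = x ^ CARD('k) + (y :: 'c) ^ CARD('k)"
proof -
  have "of_nat (CARD('k) choose i) * x ^ i * y ^ (CARD('k) - i) = 0" if "0 < i" "i < CARD('k)" for i
    using finite_field_binomial_eq_0[OF that] emb_Fq_of_nat[of "CARD('k) choose i"] by simp
  then have "(\<Sum>i\<in>{0<..<CARD('k)}. of_nat (CARD('k) choose i) * x ^ i * y ^ (CARD('k) - i)) = 0"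
    by (intro sum.neutral) auto
  moreover have "{..CARD('k)} = insert 0 (insert CARD('k) {0<..<CARD('k)})" by auto
  ultimately show ?thesis
    by (simp add: binomial_ring)
qed

lemma frobenius_power_add: "(x + y) ^ CARD('k) ^ n = x ^ CARD('k) ^ n + (y :: 'c) ^ CARD('k) ^ n"
proof (induction n)
  case (Suc n)
  have "(x + y) ^ CARD('k) ^ Suc n = ((x + y) ^ CARD('k) ^ n) ^ CARD('k)"
    by (simp add: power_mult mult.commute flip: power_mult)
  also have "\<dots> = (x ^ CARD('k) ^ n) ^ CARD('k) + (y ^ CARD('k) ^ n) ^ CARD('k)"
    by (simp add: Suc frobenius_add)
  finally show ?case
    by (simp add: mult.commute flip: power_mult)
qed simp

lemma frobenius_power_sum: "(sum f A) ^ CARD('k) ^ n = (\<Sum>x\<in>A. f x ^ CARD('k) ^ n :: 'c)"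
  by (induction A rule: infinite_finite_induct) (simp_all add: frobenius_power_add)

lemma emb_Fq_frobenius_power: "emb_Fq emb c ^ CARD('k) ^ n = emb_Fq emb c"
proof -
  have "c ^ CARD('k) ^ n = c"
    by (induction n) (simp_all add: power_mult finite_field_power_card)
  then show ?thesis by (simp flip: emb_Fq_power)
qed

lemma coeff_emb_Fqt [simp]: "coeff (emb_Fqt emb a) n = emb_Fq emb (coeff a n)"
  by (simp add: emb_Fqt_def coeff_map_poly)

lemma emb_Fqt_add: "emb_Fqt emb (a + b) = emb_Fqt emb a + emb_Fqt emb b"
  by (rule poly_eqI) (simp add: emb_Fq_add)

lemma emb_Fqt_mult: "emb_Fqt emb (a * b) = emb_Fqt emb a * emb_Fqt emb b"
  by (rule poly_eqI) (simp add: coeff_mult emb_Fq_sum emb_Fq_mult)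

lemma emb_Fqt_1 [simp]: "emb_Fqt emb 1 = 1"
  by (simp add: emb_Fqt_def)

lemma emb_Fqt_0 [simp]: "emb_Fqt emb 0 = 0"
  by (simp add: emb_Fqt_def)

lemma emb_Fqt_pCons: "emb_Fqt emb (pCons c a) = [:emb_Fq emb c:] + [:0, 1:] * emb_Fqt emb a"
  by (simp add: emb_Fqt_def map_poly_pCons)

lemma emb_Fqt_t [simp]: "emb_Fqt emb [:0, 1:] = [:0, 1:]"
  by (simp add: emb_Fqt_def map_poly_pCons)

section \<open>The action of twisted polynomials\<close>

lemma coeff_twist [simp]: "coeff (twist CARD('k) n f) i = coeff f i ^ CARD('k) ^ n"
  by (simp add: twist_def coeff_map_poly)

lemma twist_add: "twist CARD('k) n (f + g) = twist CARD('k) n f + twist CARD('k) n (g :: 'c poly)"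
  by (rule poly_eqI) (simp add: frobenius_power_add)

lemma twist_0 [simp]: "twist CARD('k) n 0 = 0"
  by (simp add: twist_def)

lemma twist_sum: "twist CARD('k) n (sum f A) = (\<Sum>x\<in>A. twist CARD('k) n (f x) :: 'c poly)"
  by (induction A rule: infinite_finite_induct) (simp_all add: twist_add)

lemma twist_mult: "twist CARD('k) n (f * g) = twist CARD('k) n f * twist CARD('k) n (g :: 'c poly)"
  by (rule poly_eqI) (simp add: coeff_mult frobenius_power_sum power_mult_distrib)

lemma twist_twist: "twist CARD('k) m (twist CARD('k) n f) = twist CARD('k) (m + n) f"
  by (rule poly_eqI) (simp add: power_add mult.commute flip: power_mult)

lemma twist_zero_exponent [simp]: "twist CARD('k) 0 f = f"
  by (simp add: twist_def)

lemma twist_emb_Fqt: "twist CARD('k) n (emb_Fqt emb a) = emb_Fqt emb a"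
  by (rule poly_eqI) (simp add: emb_Fq_frobenius_power)

lemma tau_act_eq_sum:
  "degree A \<le> N \<Longrightarrow> tau_act CARD('k) A f = (\<Sum>i\<le>N. coeff A i * twist CARD('k) i f)"
  unfolding tau_act_def by (rule sum.mono_neutral_left) (auto simp: coeff_eq_0)

lemma tau_act_0_left [simp]: "tau_act CARD('k) 0 f = 0"
  by (simp add: tau_act_def)

lemma tau_act_add_left: "tau_act CARD('k) (A + B) f = tau_act CARD('k) A f + tau_act CARD('k) B f"
  using degree_add_le_max[of A B]
  by (simp add: tau_act_eq_sum[where N = "max (degree A) (degree B)"] algebra_simps
      flip: sum.distrib)

lemma tau_act_sum_left: "tau_act CARD('k) (sum F A) f = (\<Sum>x\<in>A. tau_act CARD('k) (F x) f)"
  by (induction A rule: infinite_finite_induct) (simp_all add: tau_act_add_left)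

lemma tau_act_smult_left: "tau_act CARD('k) (smult c A) f = c * tau_act CARD('k) A f"
  by (simp add: tau_act_eq_sum[where N = "degree A"] degree_smult_le sum_distrib_left mult.assoc)

lemma tau_act_monom: "tau_act CARD('k) (monom c n) f = c * twist CARD('k) n f"
  by (simp add: tau_act_eq_sum[where N = n] degree_monom_le if_distrib[where f = "\<lambda>x. x * _"]
      cong: if_cong)

lemma tau_act_const: "tau_act CARD('k) [:c:] f = c * f"
  by (simp add: tau_act_def)

lemma tau_act_add: "tau_act CARD('k) A (f + g) = tau_act CARD('k) A f + tau_act CARD('k) A (g :: 'c poly)"
  by (simp add: tau_act_def twist_add algebra_simps sum.distrib)

lemma tau_act_0 [simp]: "tau_act CARD('k) A (0 :: 'c poly) = 0"
  by (simp add: tau_act_def)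

lemma tau_act_sum: "tau_act CARD('k) A (sum f I) = (\<Sum>x\<in>I. tau_act CARD('k) A (f x :: 'c poly))"
  by (induction I rule: infinite_finite_induct) (simp_all add: tau_act_add)

lemma tau_act_emb_Fqt_mult: "tau_act CARD('k) A (emb_Fqt emb a * f) = emb_Fqt emb a * tau_act CARD('k) A f"
  by (simp add: tau_act_def twist_mult twist_emb_Fqt sum_distrib_left mult_ac)

lemma tau_act_tau_mult: "tau_act CARD('k) (tau_mult CARD('k) A B) f = tau_act CARD('k) A (tau_act CARD('k) B (f :: 'c poly))"
proof -
  have "tau_act CARD('k) (tau_mult CARD('k) A B) f =
      (\<Sum>i\<le>degree A. \<Sum>j\<le>degree B. coeff A i * twist CARD('k) i (coeff B j) * twist CARD('k) (i + j) f)"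
    by (simp add: tau_mult_def tau_act_sum_left tau_act_monom)
  also have "\<dots> = (\<Sum>i\<le>degree A. coeff A i * twist CARD('k) i (tau_act CARD('k) B f))"
    by (simp add: tau_act_def[of _ B] twist_sum twist_mult twist_twist sum_distrib_left mult.assoc)
  finally show ?thesis by (simp add: tau_act_def[of _ A])
qed

text \<open>
  An element of \<open>L[\<tau>]\<close> acts on each coefficient of a polynomial in \<open>t\<close> separately. This is why such
  an action neither raises the degree in \<open>t\<close> nor leaves \<open>L[t]\<close>.
\<close>
lemma coeff_tau_act:
  assumes "A \<in> L_tau L"
  shows "coeff (tau_act CARD('k) A f) n = (\<Sum>i\<le>degree A. coeff (coeff A i) 0 * coeff f n ^ CARD('k) ^ i)"
proof -
  have "coeff (coeff A i * g) n = coeff (coeff A i) 0 * coeff g n" for i g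
  proof -
    obtain c where "coeff A i = [:c:]" using assms by (auto simp: L_tau_def)
    then show ?thesis by simp
  qed
  then show ?thesis by (simp add: tau_act_def coeff_sum)
qed

lemma mat_act_component: "mat_act CARD('k) A v $ i = (\<Sum>j\<in>UNIV. tau_act CARD('k) (A $ i $ j) (v $ j))"
  by (simp add: mat_act_def)

lemma mat_act_add_left: "mat_act CARD('k) (A + B) v = mat_act CARD('k) A v + mat_act CARD('k) B v"
  by (simp add: vec_eq_iff mat_act_component tau_act_add_left sum.distrib)

lemma mat_act_diff_left: "mat_act CARD('k) (A - B) v = mat_act CARD('k) A v - mat_act CARD('k) B v"
  using mat_act_add_left[of "A - B" B v] by (simp add: algebra_simps)

lemma mat_act_add: "mat_act CARD('k) A (v + w) = mat_act CARD('k) A v + mat_act CARD('k) A (w :: 'c poly^'d)"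
  by (simp add: vec_eq_iff mat_act_component tau_act_add sum.distrib)

lemma mat_act_emb_Fqt_scale:
  "mat_act CARD('k) A (emb_Fqt emb a *s v) = emb_Fqt emb a *s mat_act CARD('k) A v"
  by (simp add: vec_eq_iff mat_act_component tau_act_emb_Fqt_mult sum_distrib_left)

lemma mat_act_smult_left: "mat_act CARD('k) (map_matrix (smult c) A) v = c *s mat_act CARD('k) A v"
  by (simp add: vec_eq_iff mat_act_component tau_act_smult_left sum_distrib_left)

lemma mat_act_scalar: "mat_act CARD('k) (mat [:c:]) v = c *s v"
proof -
  have "tau_act CARD('k) (mat [:c:] $ i $ j) (v $ j) = (if i = j then c * v $ j else 0)" for i j
    by (simp add: mat_def tau_act_const)
  then show ?thesis
    by (simp add: vec_eq_iff mat_act_component)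
qed

lemma mat_act_mat_tau_mult:
  "mat_act CARD('k) (mat_tau_mult CARD('k) A B) v = mat_act CARD('k) A (mat_act CARD('k) B (v :: 'c poly^'d))"
proof -
  have "(\<Sum>j\<in>UNIV. tau_act CARD('k) (mat_tau_mult CARD('k) A B $ i $ j) (v $ j)) =
      (\<Sum>j\<in>UNIV. \<Sum>k\<in>UNIV. tau_act CARD('k) (A $ i $ k) (tau_act CARD('k) (B $ k $ j) (v $ j)))" for i
    by (simp add: mat_tau_mult_def tau_act_sum_left tau_act_tau_mult)
  also have "\<dots> i = (\<Sum>k\<in>UNIV. \<Sum>j\<in>UNIV. tau_act CARD('k) (A $ i $ k) (tau_act CARD('k) (B $ k $ j) (v $ j)))" for i
    by (rule sum.swap)
  finally show ?thesis
    by (simp add: vec_eq_iff mat_act_component tau_act_sum)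
qed

section \<open>Modules over \<open>F\<^sub>q[t]\<close>\<close>

lemma module_scale_Et: "module (scale_Et emb :: 'k poly \<Rightarrow> 'c poly^'d \<Rightarrow> _)"
  by unfold_locales
    (simp_all add: scale_Et_def vec_eq_iff emb_Fqt_add emb_Fqt_mult algebra_simps)

lemma module_vector: "module ((*s) :: 'r::comm_ring_1 \<Rightarrow> 'r^'l \<Rightarrow> _)"
  by unfold_locales (simp_all add: vec_eq_iff algebra_simps)

lemma module_scale_Sol:
  "module (scale_Sol emb :: 'k poly \<Rightarrow> ('c poly^'d) \<times> ('k poly^'l) \<Rightarrow> _)"
proof -
  interpret E: module "scale_Et emb :: 'k poly \<Rightarrow> 'c poly^'d \<Rightarrow> _" by (rule module_scale_Et)
  interpret V: module "(*s) :: 'k poly \<Rightarrow> 'k poly^'l \<Rightarrow> _" by (rule module_vector)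
  show ?thesis
    by unfold_locales
      (auto simp: scale_Sol_def E.scale_right_distrib E.scale_left_distrib
        V.scale_right_distrib V.scale_left_distrib)
qed

lemma combination_component: "combination emb P a $ j = (\<Sum>i\<in>UNIV. emb_Fqt emb (a $ i) * [:P i $ j:])"
  by (simp add: combination_def const_vec_def)

lemma combination_add: "combination emb P (a + b) = combination emb P a + combination emb P b"
  by (simp add: vec_eq_iff combination_component emb_Fqt_add algebra_simps smult_add_right
      flip: sum.distrib)

lemma combination_scale: "combination emb P (r *s a) = scale_Et emb r (combination emb P a)"
  by (simp add: combination_def scale_Et_def vec_eq_iff emb_Fqt_mult sum_distrib_left mult.assoc)

lemma module_hom_combination:
  "module_hom (*s) (scale_Et emb) (combination emb P :: _ \<Rightarrow> 'c poly^'d)"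
  by (intro module_hom.intro module_hom_axioms.intro module_vector module_scale_Et
      combination_add combination_scale)

text \<open>The coefficient of each power of \<open>t\<close> in a combination is an \<open>F\<^sub>q\<close>-linear combination of the \<open>P\<^sub>i\<close>.\<close>
lemma inj_combination:
  assumes "linearly_independent_Fq emb P"
  shows "inj (combination emb P)"
proof -
  interpret module_hom "(*s)" "scale_Et emb" "combination emb P" by (rule module_hom_combination)
  have "a = 0" if "combination emb P a = 0" for a
  proof -
    have "(\<Sum>i\<in>UNIV. emb_Fq emb (coeff (a $ i) n) *s P i) = 0" for n
    proof -
      have "coeff (combination emb P a $ j) n = 0" for j by (simp add: that)
      then show ?thesis
        by (simp add: vec_eq_iff combination_component coeff_sum mult.commute)
    qed
    then have "coeff (a $ i) n = 0" for i n
      using assms unfolding linearly_independent_Fq_def by fast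
    then show ?thesis by (simp add: vec_eq_iff poly_eq_iff)
  qed
  then show ?thesis by (metis diff eq_iff_diff_eq_0 injI)
qed

end

section \<open>Solutions of a \<open>t\<close>-module\<close>

locale t_module_over = C_infinity emb
  for emb :: "'k::{field,finite} fls \<Rightarrow> 'c::{field,complete_space}" +
  fixes L :: "'c set" and \<phi> :: "'k poly \<Rightarrow> 'c poly poly^'d::finite^'d"
  assumes finite_extension: "finite_extension_of_K emb L"
    and t_module: "t_module emb L \<phi>"
begin

lemma L_0 [simp]: "0 \<in> L"
  and L_1 [simp]: "1 \<in> L"
  and L_add: "x \<in> L \<Longrightarrow> y \<in> L \<Longrightarrow> x + y \<in> L"
  and L_mult: "x \<in> L \<Longrightarrow> y \<in> L \<Longrightarrow> x * y \<in> L"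
  and L_uminus: "x \<in> L \<Longrightarrow> - x \<in> L"
  using finite_extension by (auto simp: finite_extension_of_K_def is_subfield_def)

lemma L_sum: "(\<And>x. x \<in> A \<Longrightarrow> f x \<in> L) \<Longrightarrow> sum f A \<in> L"
  by (induction A rule: infinite_finite_induct) (auto intro: L_add)

lemma L_power: "x \<in> L \<Longrightarrow> x ^ n \<in> L"
  by (induction n) (auto intro: L_mult)

lemma emb_Fq_in_L: "emb_Fq emb c \<in> L"
proof -
  have "emb_Fq emb c = poly (emb_Fqt emb [:c:]) (theta emb) / poly (emb_Fqt emb 1) (theta emb)"
    by (simp add: emb_Fqt_pCons)
  then have "emb_Fq emb c \<in> field_K emb"
    unfolding field_K_def by (intro CollectI exI[of _ "[:c:]"] exI[of _ 1]) auto
  then show ?thesis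
    using finite_extension by (auto simp: finite_extension_of_K_def)
qed

lemma E_t_diff: "x \<in> E_t L \<Longrightarrow> y \<in> E_t L \<Longrightarrow> x - y \<in> E_t L"
  unfolding E_t_def using L_add L_uminus
  by (fastforce simp: diff_conv_add_uminus simp del: add_uminus_conv_diff)

lemma E_t_scale: "x \<in> E_t L \<Longrightarrow> scale_Et emb a x \<in> E_t L"
  unfolding E_t_def scale_Et_def
  by (auto simp: coeff_mult intro!: L_sum L_mult emb_Fq_in_L)

lemma subspace_E_t: "module.subspace (scale_Et emb) (E_t L :: ('c poly^'d) set)"
proof -
  interpret E: module "scale_Et emb :: 'k poly \<Rightarrow> 'c poly^'d \<Rightarrow> _" by (rule module_scale_Et)
  show ?thesis
    by (rule E.subspaceI) (auto simp: E_t_scale, auto simp: E_t_def L_add)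
qed

lemma const_vec_in_E_t: "v \<in> E_L L \<Longrightarrow> const_vec v \<in> E_t L"
  by (auto simp: E_t_def E_L_def const_vec_def coeff_pCons split: nat.split)

abbreviation act :: "'k poly \<Rightarrow> 'c poly^'d \<Rightarrow> 'c poly^'d" where
  "act a \<equiv> mat_act CARD('k) (\<phi> a)"

lemma phi_in_L_tau: "\<phi> a $ i $ j \<in> L_tau L"
  using t_module by (simp add: t_module_def)

text \<open>Writing \<open>c + t a = c \<cdot> 1 + t \<cdot> a\<close> reduces the action of \<open>\<phi>\<close> to scalars and to \<open>\<phi>\<^sub>t\<close>.\<close>
lemma act_pCons: "act (pCons c a) x = [:emb_Fq emb c:] *s x + act [:0, 1:] (act a x)"
proof -
  have "pCons c a = smult c 1 + [:0, 1:] * a" by simp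
  moreover have "\<phi> (smult c 1 + [:0, 1:] * a) =
      map_matrix (smult [:emb_Fq emb c:]) (mat 1) + mat_tau_mult CARD('k) (\<phi> [:0, 1:]) (\<phi> a)"
    using t_module unfolding t_module_def by metis
  moreover have "mat_act CARD('k) (mat 1) x = x"
    using mat_act_scalar[of 1 x] by (simp flip: one_pCons)
  ultimately show ?thesis
    by (simp only: mat_act_add_left mat_act_smult_left mat_act_mat_tau_mult)
qed

lemma act_0: "act 0 x = 0"
proof -
  have "\<phi> (0 + 0) = \<phi> 0 + \<phi> 0" using t_module unfolding t_module_def by blast
  then have "\<phi> 0 = 0" by simp
  then show ?thesis by (simp add: vec_eq_iff mat_act_component)
qed

lemma coeff_act_eq_0: "(\<And>j. coeff (x $ j) n = 0) \<Longrightarrow> coeff (act a x $ i) n = 0"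
  by (simp add: mat_act_component coeff_sum coeff_tau_act[OF phi_in_L_tau] power_0_left)

lemma act_in_E_t:
  assumes "x \<in> E_t L"
  shows "act a x \<in> E_t L"
proof -
  have "coeff (coeff (\<phi> a $ i $ j) k) 0 \<in> L" for i j k
  proof -
    obtain c where "c \<in> L" "coeff (\<phi> a $ i $ j) k = [:c:]"
      using phi_in_L_tau[of a i j] unfolding L_tau_def by blast
    then show ?thesis by simp
  qed
  then show ?thesis
    using assms unfolding E_t_def
    by (auto simp: mat_act_component coeff_sum coeff_tau_act[OF phi_in_L_tau]
        intro!: L_sum L_mult L_power)
qed

lemma phi_t_minus_t_eq: "phi_t_minus_t \<phi> x = act [:0, 1:] x - [:0, 1:] *s x"
  by (simp add: phi_t_minus_t_def mat_act_diff_left mat_act_scalar)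

lemma phi_t_minus_t_add: "phi_t_minus_t \<phi> (x + y) = phi_t_minus_t \<phi> x + phi_t_minus_t \<phi> y"
  by (simp add: phi_t_minus_t_def mat_act_add)

lemma phi_t_minus_t_scale:
  "phi_t_minus_t \<phi> (scale_Et emb a x) = scale_Et emb a (phi_t_minus_t \<phi> x)"
  by (simp add: phi_t_minus_t_def scale_Et_def mat_act_emb_Fqt_scale)

lemma module_hom_phi_t_minus_t:
  "module_hom (scale_Et emb) (scale_Et emb) (phi_t_minus_t \<phi>)"
  by (intro module_hom.intro module_hom_axioms.intro module_scale_Et
      phi_t_minus_t_add phi_t_minus_t_scale)

text \<open>
  If \<open>N\<close> is the degree of \<open>x\<close> in \<open>t\<close>, the coefficient of \<open>t\<^bsup>N+1\<^esup>\<close> in \<open>(\<phi>\<^sub>t - t) x\<close> comes from \<open>-t x\<close>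
  alone and is therefore the negative of the leading coefficient of \<open>x\<close>.
\<close>
lemma eq_0_if_phi_t_minus_t_const:
  assumes const: "\<And>i n. n > 0 \<Longrightarrow> coeff (phi_t_minus_t \<phi> x $ i) n = 0"
  shows "x = 0"
proof (rule ccontr)
  assume "x \<noteq> 0"
  define S where "S = {n. \<exists>i. coeff (x $ i) n \<noteq> 0}"
  have "S \<subseteq> (\<Union>i. {..degree (x $ i)})"
    by (auto simp: S_def intro: le_degree)
  then have fin: "finite S" by (rule finite_subset) simp
  have "S \<noteq> {}"
    using \<open>x \<noteq> 0\<close> by (auto simp: S_def vec_eq_iff poly_eq_iff)
  then obtain i where i: "coeff (x $ i) (Max S) \<noteq> 0"
    using Max_in[OF fin] by (auto simp: S_def)
  have "Suc (Max S) \<notin> S"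
    using Max_ge[OF fin, of "Suc (Max S)"] by auto
  then have "coeff (act [:0, 1:] x $ i) (Suc (Max S)) = 0"
    by (intro coeff_act_eq_0) (auto simp: S_def)
  then show False
    using const[of "Suc (Max S)" i] i by (simp add: phi_t_minus_t_eq)
qed

lemma inj_phi_t_minus_t: "inj (phi_t_minus_t \<phi>)"
proof -
  interpret module_hom "scale_Et emb" "scale_Et emb" "phi_t_minus_t \<phi>"
    by (rule module_hom_phi_t_minus_t)
  have "x = 0" if "phi_t_minus_t \<phi> x = 0" for x
    by (rule eq_0_if_phi_t_minus_t_const) (simp add: that)
  then show ?thesis by (metis diff eq_iff_diff_eq_0 injI)
qed

lemma subspace_image_phi_t_minus_t:
  "module.subspace (scale_Et emb) (phi_t_minus_t \<phi> ` E_t L)"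
  by (rule module_hom.subspace_image[OF module_hom_phi_t_minus_t subspace_E_t])

text \<open>
  For \<open>a = c + t b\<close> and \<open>b x - \<phi>\<^sub>b(x) = (\<phi>\<^sub>t - t) y\<close> one has
  \<open>a x - \<phi>\<^sub>a(x) = t (b x - \<phi>\<^sub>b(x)) - (\<phi>\<^sub>t - t) \<phi>\<^sub>b(x) = (\<phi>\<^sub>t - t) (t y - \<phi>\<^sub>b(x))\<close>, since \<open>\<phi>\<^sub>t\<close> commutes
  with multiplication by \<open>t\<close>.
\<close>
lemma scale_minus_phi_in_image:
  assumes "x \<in> E_t L"
  shows "scale_Et emb a x - act a x \<in> phi_t_minus_t \<phi> ` E_t L"
proof (induction a)
  case 0
  have "phi_t_minus_t \<phi> 0 = 0"
    using phi_t_minus_t_add[of 0 0] by simp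
  moreover have "0 \<in> E_t L" by (simp add: E_t_def)
  ultimately show ?case
    by (auto simp: scale_Et_def act_0 intro: rev_image_eqI)
next
  case (pCons c b)
  interpret module_hom "scale_Et emb" "scale_Et emb" "phi_t_minus_t \<phi>"
    by (rule module_hom_phi_t_minus_t)
  obtain y where y: "y \<in> E_t L" "scale_Et emb b x - act b x = phi_t_minus_t \<phi> y"
    using pCons.IH by blast
  let ?t = "scale_Et emb [:0, 1:]"
  have "scale_Et emb (pCons c b) x = [:emb_Fq emb c:] *s x + ?t (scale_Et emb b x)"
    by (simp only: scale_Et_def emb_Fqt_pCons[of c b] emb_Fqt_t vector_sadd_rdistrib vector_smult_assoc)
  then have "scale_Et emb (pCons c b) x - act (pCons c b) x =
      ?t (scale_Et emb b x) - act [:0, 1:] (act b x)"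
    by (simp only: act_pCons[of c b] add_diff_cancel_left)
  also have "\<dots> = ?t (scale_Et emb b x - act b x) - phi_t_minus_t \<phi> (act b x)"
    by (simp only: phi_t_minus_t_eq scale_Et_def emb_Fqt_t vector_ssub_ldistrib diff_diff_eq2
        diff_add_cancel)
  also have "\<dots> = phi_t_minus_t \<phi> (?t y - act b x)"
    by (simp add: y diff scale)
  finally show ?case
    using y(1) assms by (auto intro!: E_t_diff E_t_scale act_in_E_t)
qed

lemma relation_iff_combination_in_image:
  assumes P: "\<And>i. P i \<in> E_L L"
  shows "a \<in> relations \<phi> P \<longleftrightarrow> combination emb P a \<in> phi_t_minus_t \<phi> ` E_t L"
proof -
  interpret module_hom "scale_Et emb" "scale_Et emb" "phi_t_minus_t \<phi>"
    by (rule module_hom_phi_t_minus_t)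
  let ?I = "phi_t_minus_t \<phi> ` E_t L"
  define w where "w = (\<Sum>i\<in>UNIV. act (a $ i) (const_vec (P i)))"
  have "combination emb P a - w =
      (\<Sum>i\<in>UNIV. scale_Et emb (a $ i) (const_vec (P i)) - act (a $ i) (const_vec (P i)))"
    by (simp add: combination_def w_def scale_Et_def sum_subtractf)
  also have "\<dots> \<in> ?I"
    by (intro m1.subspace_sum subspace_image_phi_t_minus_t scale_minus_phi_in_image const_vec_in_E_t P)
  finally have diff_w: "combination emb P a - w \<in> ?I" .
  \<comment> \<open>Each summand of \<open>w\<close> is \<open>\<phi>\<close> applied to a vector constant in \<open>t\<close>, so \<open>w\<close> is constant.\<close>
  have w_eq_0: "w = 0" if w: "w \<in> ?I"
  proof -
    obtain x where x: "w = phi_t_minus_t \<phi> x" using w by blast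
    have "coeff (w $ i) n = 0" if "n > 0" for i n
      unfolding w_def
      using that by (simp add: coeff_sum)
        (intro sum.neutral ballI coeff_act_eq_0, simp add: const_vec_def coeff_eq_0)
    then have "x = 0" using eq_0_if_phi_t_minus_t_const[of x] x by simp
    then show ?thesis by (simp add: x zero)
  qed
  have "combination emb P a \<in> ?I \<longleftrightarrow> w = 0"
  proof
    assume "combination emb P a \<in> ?I"
    from m1.subspace_diff[OF subspace_image_phi_t_minus_t this diff_w] show "w = 0"
      by (intro w_eq_0) simp
  qed (use diff_w in simp)
  then show ?thesis by (simp add: relations_def w_def)
qed

lemma subspace_Sol: "module.subspace (scale_Sol emb) (Sol emb L \<phi> (P :: 'l::finite \<Rightarrow> _))"
proof -
  interpret S: module "scale_Sol emb :: 'k poly \<Rightarrow> ('c poly^'d) \<times> ('k poly^'l) \<Rightarrow> _"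
    by (rule module_scale_Sol)
  interpret D: module_hom "scale_Et emb" "scale_Et emb" "phi_t_minus_t \<phi>"
    by (rule module_hom_phi_t_minus_t)
  interpret C: module_hom "(*s)" "scale_Et emb" "combination emb P" by (rule module_hom_combination)
  show ?thesis
  proof (rule S.subspaceI)
    show "0 \<in> Sol emb L \<phi> P"
      using D.m1.subspace_0[OF subspace_E_t] D.zero C.zero by (simp add: Sol_def zero_prod_def)
    show "u + v \<in> Sol emb L \<phi> P" if "u \<in> Sol emb L \<phi> P" "v \<in> Sol emb L \<phi> P" for u v
      using that D.m1.subspace_add[OF subspace_E_t]
      by (cases u; cases v) (simp add: Sol_def phi_t_minus_t_add combination_add)
    show "scale_Sol emb r u \<in> Sol emb L \<phi> P" if "u \<in> Sol emb L \<phi> P" for r u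
      using that
      by (cases u) (simp add: Sol_def scale_Sol_def E_t_scale phi_t_minus_t_scale combination_scale)
  qed
qed

lemma module_hom_rho1: "module_hom (scale_Sol emb) (*s) (rho1 :: ('c poly^'d) \<times> ('k poly^'l) \<Rightarrow> _)"
  by (intro module_hom.intro module_hom_axioms.intro module_scale_Sol module_vector)
    (auto simp: rho1_def scale_Sol_def)

lemma module_hom_rho2:
  "module_hom (scale_Sol emb) (scale_Et emb) (rho2 \<phi> :: _ \<times> ('k poly^'l) \<Rightarrow> _)"
  by (intro module_hom.intro module_hom_axioms.intro module_scale_Sol module_scale_Et)
    (auto simp: rho2_def scale_Sol_def phi_t_minus_t_add phi_t_minus_t_scale)

lemma submodule_iso_rho1:
  assumes "\<And>i. P i \<in> E_L L"
  shows "submodule_iso (scale_Sol emb) (Sol emb L \<phi> P) (*s) (relations \<phi> P) rho1"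
proof (rule submodule_iso_if_inj_on[OF module_hom_rho1 subspace_Sol])
  show "inj_on rho1 (Sol emb L \<phi> P)"
    by (auto simp: inj_on_def rho1_def Sol_def intro: injD[OF inj_phi_t_minus_t])
  show "rho1 ` Sol emb L \<phi> P = relations \<phi> P"
    by (force simp: relation_iff_combination_in_image[OF assms] rho1_def Sol_def)
qed

lemma submodule_iso_rho2:
  assumes "linearly_independent_Fq emb P"
  shows "submodule_iso (scale_Sol emb) (Sol emb L \<phi> P)
    (scale_Et emb) (special_polynomials emb L \<phi> P) (rho2 \<phi>)"
proof (rule submodule_iso_if_inj_on[OF module_hom_rho2 subspace_Sol])
  show "inj_on (rho2 \<phi>) (Sol emb L \<phi> P)"
    by (auto simp: inj_on_def rho2_def Sol_def
        intro: injD[OF inj_phi_t_minus_t] injD[OF inj_combination[OF assms]])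
  show "rho2 \<phi> ` Sol emb L \<phi> P = special_polynomials emb L \<phi> P"
    by (force simp: rho2_def Sol_def special_polynomials_def module_M2_def)
qed

end

theorem theorem3p1p5:
  fixes emb :: "'k::{field,finite} fls \<Rightarrow> 'c::{field,complete_space}"
    and L :: "'c set"
    and \<phi> :: "'k poly \<Rightarrow> 'c poly poly^'d::finite^'d"
    and P :: "'l::finite \<Rightarrow> 'c^'d"
  assumes "C_infinity emb"
    and "finite_extension_of_K emb L"
    and "t_module emb L \<phi>"
    and "\<And>i. P i \<in> E_L L"
    and "linearly_independent_Fq emb P"
  shows "submodule_iso (scale_Sol emb) (Sol emb L \<phi> P) (*s) (relations \<phi> P) rho1 \<and>
         submodule_iso (scale_Sol emb) (Sol emb L \<phi> P)
           (scale_Et emb) (special_polynomials emb L \<phi> P) (rho2 \<phi>) \<and>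
         submodule_iso (*s) (relations \<phi> P) (scale_Et emb) (special_polynomials emb L \<phi> P)
           (rho2 \<phi> \<circ> inv_into (Sol emb L \<phi> P) rho1) \<and>
         (\<forall>a\<in>relations \<phi> P. (rho2 \<phi> \<circ> inv_into (Sol emb L \<phi> P) rho1) a = combination emb P a)"
proof -
  interpret t_module_over emb L \<phi>
    using assms by (simp add: t_module_over_def t_module_over_axioms_def)
  note rho1 = submodule_iso_rho1[of P, OF assms(4)]
    and rho2 = submodule_iso_rho2[OF assms(5)]
  have "(rho2 \<phi> \<circ> inv_into (Sol emb L \<phi> P) rho1) a = combination emb P a"
    if "a \<in> relations \<phi> P" for a
  proof -
    have a: "a \<in> rho1 ` Sol emb L \<phi> P"
      using rho1 that by (simp add: submodule_iso_def bij_betw_def)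
    obtain x b where xb: "inv_into (Sol emb L \<phi> P) rho1 a = (x, b)" by fastforce
    have "(x, b) \<in> Sol emb L \<phi> P" and "b = a"
      using inv_into_into[OF a] f_inv_into_f[OF a] unfolding xb by (simp_all add: rho1_def)
    then have "phi_t_minus_t \<phi> x = combination emb P a" by (simp add: Sol_def)
    then show ?thesis by (simp add: xb rho2_def)
  qed
  then show ?thesis
    by (intro conjI ballI rho1 rho2 submodule_iso_comp[OF submodule_iso_inv_into[OF rho1] rho2])
qed

end
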